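(* Let $\mathcal{T}=(\mathcal{N}^+,\mathcal{E})$ be a directed tree network with root $0$, with line impedances $z_{ij}=r_{ij}+\boldsymbol{i}x_{ij}$ for $(i,j)\in\mathcal{E}$. Let $(p_j,q_j)_{j\in\mathcal{N}}$ be given power injections, let $(P_{ij},Q_{ij},\ell_{ij})_{(i,j)\in\mathcal{E}}$, $(v_i)_{i\in\mathcal{N}^+}$ satisfy the nonlinear distribution power flow model, and let $(\hat P_{ij},\hat Q_{ij})_{(i,j)\in\mathcal{E}}$, $(\hat v_i)_{i\in\mathcal{N}^+}$ satisfy the linearized distribution power flow model with the same power injections and the same root voltage, $\hat v_0=v_0$ (both models are given in the context). For $\xi\in\mathcal{N}$, let $g_\xi$ and $\eta_\xi$ denote the active and reactive power loss downstream of node $\xi$, that is, $$g_{\xi}=\sum_{(\alpha,\beta)\in \operatorname{down}(\xi)}r_{\alpha\beta}\ell_{\alpha\beta},\qquad \eta_{\xi}=\sum_{(\alpha,\beta)\in \operatorname{down}(\xi)}x_{\alpha\beta}\ell_{\alpha\beta}.$$ Then the voltage error induced by the linearized model is, for all $h\in\mathcal{N}$, $$\hat{v}_{h}-v_{h}= \sum_{(\zeta,\xi)\in \mathbb{P}_{h}}\Big(2\left(r_{\zeta\xi}g_{\xi}+x_{\zeta\xi}\eta_{\xi}\right)+(r_{\zeta\xi}^2+x_{\zeta\xi}^2)\ell_{\zeta\xi}\Big).$$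
   Context: Network. $\mathcal{N}=\{1,\dots,N\}$ and $\mathcal{N}^+=\mathcal{N}\cup\{0\}$. The directed graph $\mathcal{T}=(\mathcal{N}^+,\mathcal{E})$ is a finite tree rooted at node $0$ (the substation, or slack bus) with all lines directed away from the root: in a line $(i,j)\in\mathcal{E}$, node $i$ is the unique parent of node $j$. Each line $(i,j)$ has series impedance $z_{ij}=r_{ij}+\boldsymbol{i}x_{ij}$ with $r_{ij},x_{ij}$ real and $\boldsymbol{i}$ the imaginary unit, so $|z_{ij}|^2=r_{ij}^2+x_{ij}^2$. For $j\in\mathcal{N}$, the real numbers $p_j,q_j$ are the net active and reactive power injections at node $j$. All the quantities below are real: $v_i$ is the squared voltage magnitude at node $i\in\mathcal{N}^+$, $\ell_{ij}$ is the squared current magnitude on line $(i,j)$, and $P_{ij},Q_{ij}$ are the sending-end active and reactive power on line $(i,j)$. Nonlinear distribution power flow model. For every $j\in\mathcal{N}$ with parent $i$ (equivalently, for every $(i,j)\in\mathcal{E}$): $$P_{ij}=-p_j+\sum_{k:(j,k)\in\mathcal{E}}P_{jk}+r_{ij}\ell_{ij},\qquad Q_{ij}=-q_j+\sum_{k:(j,k)\in\mathcal{E}}Q_{jk}+x_{ij}\ell_{ij},$$ $$v_j=v_i-2(r_{ij}P_{ij}+x_{ij}Q_{ij})+|z_{ij}|^2\ell_{ij},\qquad \ell_{ij}v_i=P_{ij}^2+Q_{ij}^2.$$ Linearized distribution power flow model. For every $j\in\mathcal{N}$ with parent $i$: $$\hat P_{ij}=-p_j+\sum_{k:(j,k)\in\mathcal{E}}\hat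 P_{jk},\qquad \hat Q_{ij}=-q_j+\sum_{k:(j,k)\in\mathcal{E}}\hat Q_{jk},\qquad \hat v_j=\hat v_i-2(r_{ij}\hat P_{ij}+x_{ij}\hat Q_{ij}).$$ Notation. For $h\in\mathcal{N}$, $\mathbb{P}_h\subseteq\mathcal{E}$ is the set of lines on the unique path between node $h$ and the root $0$. For $\xi\in\mathcal{N}$, $\operatorname{down}(\xi)\subseteq\mathcal{E}$ is the set of lines downstream of node $\xi$, i.e. the lines $(\alpha,\beta)\in\mathcal{E}$ such that $\alpha=\xi$ or $\alpha$ is a descendant of $\xi$ (the line from the parent of $\xi$ to $\xi$ is not included). Empty sums are $0$. *)

theory Defs
  imports Complex_Main "Graph_Theory.Pair_Digraph"
begin

text \<open>
  The predicate \<open>tree\<close> of \<open>Graph_Theory.Digraph_Component\<close> only forbids directed cycles, so it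
  does not exclude two lines entering the same node. A finite tree with all lines directed away
  from the root is described instead by unique walks from the root. Uniqueness is required of
  walks, not only of simple paths, since the latter would admit lines leading back
  towards the root.
\<close>

locale directed_tree = pair_fin_digraph T for T :: "'a pair_pre_digraph" +
  fixes root :: 'a
  assumes root_in_verts: "root \<in> pverts T"
    and unique_awalk: "v \<in> pverts T \<Longrightarrow> \<exists>!w. awalk root w v"
begin

definition path_lines :: "'a \<Rightarrow> ('a \<times> 'a) set" where
  "path_lines h = set (THE w. apath root w h)"

lemma unique_apath:
  assumes "h \<in> pverts T"
  shows "\<exists>!w. apath root w h"
  using unique_awalk[OF assms] by (metis apath_awalk_to_apath awalkI_apath)

lemma awalk_snoc:
  assumes "awalk root w i" "(i, j) \<in> parcs T"
  shows "awalk root (w @ [(i, j)]) j"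
  using assms by (auto simp: awalk_append_iff awalk_Cons_iff awalk_Nil_iff in_arcsD2 elim!: awalkE)

lemma no_line_into_root: "(i, root) \<notin> parcs T"
proof
  assume line: "(i, root) \<in> parcs T"
  then obtain w where "awalk root w i"
    using unique_awalk in_arcsD1 by blast
  then have "awalk root (w @ [(i, root)]) root"
    using line by (rule awalk_snoc)
  moreover have "awalk root [] root"
    using root_in_verts by (simp add: awalk_Nil_iff)
  ultimately show False
    using unique_awalk[OF root_in_verts] by blast
qed

lemma unique_parent:
  assumes "j \<in> pverts T" "j \<noteq> root"
  shows "\<exists>!i. (i, j) \<in> parcs T"
proof -
  obtain w where w: "awalk root w j"
    using unique_awalk[OF assms(1)] by blast
  with assms(2) have "w \<noteq> []"
    by (auto simp: awalk_Nil_iff)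
  then obtain w' e where "w = w' @ [e]"
    by (metis rev_exhaust)
  with w have "(fst e, j) \<in> parcs T"
    by (auto simp: awalk_append_iff awalk_Cons_iff awalk_Nil_iff)
  moreover have "i = i'" if lines: "(i, j) \<in> parcs T" "(i', j) \<in> parcs T" for i i'
  proof -
    obtain u u' where "awalk root u i" "awalk root u' i'"
      using unique_awalk[OF in_arcsD1[OF lines(1)]] unique_awalk[OF in_arcsD1[OF lines(2)]] by blast
    then have "awalk root (u @ [(i, j)]) j" "awalk root (u' @ [(i', j)]) j"
      using lines awalk_snoc by auto
    then have "u @ [(i, j)] = u' @ [(i', j)]"
      using unique_awalk[OF assms(1)] by blast
    then show ?thesis by simp
  qed
  ultimately show ?thesis by blast
qed

end

definition down :: "'a pair_pre_digraph \<Rightarrow> 'a \<Rightarrow> ('a \<times> 'a) set" where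
  "down T \<xi> = {(\<alpha>, \<beta>) \<in> parcs T. \<alpha> = \<xi> \<or> \<xi> \<rightarrow>\<^sup>+\<^bsub>T\<^esub> \<alpha>}"

definition nonlinear_power_flow ::
  "'a pair_pre_digraph \<Rightarrow> ('a \<Rightarrow> 'a \<Rightarrow> real) \<Rightarrow> ('a \<Rightarrow> 'a \<Rightarrow> real) \<Rightarrow> ('a \<Rightarrow> real) \<Rightarrow> ('a \<Rightarrow> real) \<Rightarrow>
    ('a \<Rightarrow> 'a \<Rightarrow> real) \<Rightarrow> ('a \<Rightarrow> 'a \<Rightarrow> real) \<Rightarrow> ('a \<Rightarrow> 'a \<Rightarrow> real) \<Rightarrow> ('a \<Rightarrow> real) \<Rightarrow> bool" where
  "nonlinear_power_flow T r x p q P Q l v \<longleftrightarrow>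
    (\<forall>(i, j) \<in> parcs T.
      P i j = - p j + (\<Sum>k | (j, k) \<in> parcs T. P j k) + r i j * l i j \<and>
      Q i j = - q j + (\<Sum>k | (j, k) \<in> parcs T. Q j k) + x i j * l i j \<and>
      v j = v i - 2 * (r i j * P i j + x i j * Q i j) + (cmod (Complex (r i j) (x i j)))\<^sup>2 * l i j \<and>
      l i j * v i = (P i j)\<^sup>2 + (Q i j)\<^sup>2)"

definition linearized_power_flow ::
  "'a pair_pre_digraph \<Rightarrow> ('a \<Rightarrow> 'a \<Rightarrow> real) \<Rightarrow> ('a \<Rightarrow> 'a \<Rightarrow> real) \<Rightarrow> ('a \<Rightarrow> real) \<Rightarrow> ('a \<Rightarrow> real) \<Rightarrow>
    ('a \<Rightarrow> 'a \<Rightarrow> real) \<Rightarrow> ('a \<Rightarrow> 'a \<Rightarrow> real) \<Rightarrow> ('a \<Rightarrow> real) \<Rightarrow> bool" where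
  "linearized_power_flow T r x p q P Q v \<longleftrightarrow>
    (\<forall>(i, j) \<in> parcs T.
      P i j = - p j + (\<Sum>k | (j, k) \<in> parcs T. P j k) \<and>
      Q i j = - q j + (\<Sum>k | (j, k) \<in> parcs T. Q j k) \<and>
      v j = v i - 2 * (r i j * P i j + x i j * Q i j))"

end

theory Submission
  imports Defs
begin

text \<open>
  Subtracting the two models line by line, the error \<open>P - P_hat\<close> on a line satisfies the branch
  flow recursion whose injections are the line losses, so it is the loss on the line plus the loss
  downstream of its head. The voltage error therefore increases along a line by
  \<open>2 * (r * g + x * \<eta>) + 2 * \<bar>z\<bar>\<^sup>2 * l - \<bar>z\<bar>\<^sup>2 * l\<close>, and these increments telescope along the path
  from the root.
\<close>

context directed_tree
begin

lemma eq_awalk: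
  assumes "awalk root w v" "awalk root w' v"
  shows "w = w'"
  using assms unique_awalk[of v] by (metis awalk_last_in_verts)

text \<open>Appending a cycle at \<open>v\<close> to the walk from the root would give a second walk
  to \<open>v\<close>.\<close>

lemma not_reachable1_self: "\<not> v \<rightarrow>\<^sup>+\<^bsub>T\<^esub> v"
proof
  assume cycle: "v \<rightarrow>\<^sup>+\<^bsub>T\<^esub> v"
  then obtain c where c: "awalk v c v" "c \<noteq> []"
    by (auto simp: reachable1_awalk)
  moreover obtain w where w: "awalk root w v"
    using unique_awalk[of v] awalk_hd_in_verts c(1) by (auto simp: awalk_def)
  ultimately have "awalk root (w @ c) v"
    by auto
  then have "w @ c = w"
    using w by (rule eq_awalk)
  with c(2) show False
    by simp
qed

text \<open>A common descendant of two children ends two walks from the root that share the prefix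
  up to \<open>j\<close>; uniqueness forces the same next line. Hence distinct children have
  disjoint subtrees.\<close>

lemma eq_child_if_reachable:
  assumes "(j, k) \<in> parcs T" "(j, k') \<in> parcs T"
    and "k \<rightarrow>\<^sup>*\<^bsub>T\<^esub> \<beta>" "k' \<rightarrow>\<^sup>*\<^bsub>T\<^esub> \<beta>"
  shows "k = k'"
proof -
  obtain w where w: "awalk root w j"
    using unique_awalk in_arcsD1[OF assms(1)] by blast
  obtain u u' where "awalk k u \<beta>" "awalk k' u' \<beta>"
    using assms(3,4) by (auto simp: reachable_awalk)
  with assms(1,2) w have "awalk root (w @ (j, k) # u) \<beta>" "awalk root (w @ (j, k') # u') \<beta>"
    by (auto simp: awalk_append_iff awalk_Cons_iff awalk_Nil_iff awalk_def)
  then have "w @ (j, k) # u = w @ (j, k') # u'"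
    by (rule eq_awalk)
  then show ?thesis
    by simp
qed

lemma arcs_ends_eq: "arcs_ends T = parcs T"
  by (simp add: arcs_ends_def arc_to_ends_def)

lemma finite_down: "finite (down T j)"
  by (rule finite_subset[OF _ pair_finite_arcs]) (auto simp: down_def)

lemma reachable_if_mem_down:
  assumes "(\<alpha>, \<beta>) \<in> down T k"
  shows "k \<rightarrow>\<^sup>+\<^bsub>T\<^esub> \<beta>"
  using assms unfolding down_def arcs_ends_eq
  by (auto intro: trancl_into_trancl)

lemma down_eq_UN_children:
  "down T j = (\<Union>k \<in> {k. (j, k) \<in> parcs T}. insert (j, k) (down T k))"
proof -
  have step: "(j \<rightarrow>\<^sup>+\<^bsub>T\<^esub> \<alpha>) \<longleftrightarrow> (\<exists>k. (j, k) \<in> parcs T \<and> (\<alpha> = k \<or> k \<rightarrow>\<^sup>+\<^bsub>T\<^esub> \<alpha>))" for \<alpha>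
    unfolding arcs_ends_eq by (blast intro: trancl_into_trancl2 elim: converse_tranclE)
  show ?thesis
    unfolding down_def step by auto
qed

text \<open>This brings sums over \<open>down\<close> into the shape of the power balance at a node,
  a sum over its outgoing lines.\<close>

lemma sum_down:
  fixes c :: "'a \<times> 'a \<Rightarrow> 'b :: comm_monoid_add"
  shows "sum c (down T j) = (\<Sum>k | (j, k) \<in> parcs T. c (j, k) + sum c (down T k))"
proof -
  let ?K = "{k. (j, k) \<in> parcs T}"
  have "finite ?K"
    by (rule finite_subset[of _ "snd ` parcs T"]) (auto intro: rev_image_eqI simp: pair_finite_arcs)
  moreover have disjoint: "insert (j, k) (down T k) \<inter> insert (j, k') (down T k') = {}"
    if "k \<in> ?K" "k' \<in> ?K" "k \<noteq> k'" for k k'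
  proof -
    \<comment> \<open>A line shared by two blocks would have a head that descends from both
      children. Reachability is reflexive here because the line from \<open>j\<close> to
      \<open>m\<close> has head \<open>m\<close> itself.\<close>
    have "m \<rightarrow>\<^sup>*\<^bsub>T\<^esub> b" if "m \<in> ?K" "(a, b) \<in> insert (j, m) (down T m)" for a b m
      using that reachable_if_mem_down reachable1_reachable by (auto dest: in_arcsD2)
    with that show ?thesis
      using eq_child_if_reachable by (metis mem_Collect_eq disjoint_iff surj_pair)
  qed
  ultimately have "sum c (down T j) = (\<Sum>k\<in>?K. sum c (insert (j, k) (down T k)))"
    unfolding down_eq_UN_children[of j] by (intro sum.UNION_disjoint) (auto simp: finite_down)
  \<comment> \<open>The line from \<open>j\<close> to \<open>k\<close> is not in
    \<open>down T k\<close>, as \<open>k\<close> would then lie on a cycle.\<close>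
  also have "\<dots> = (\<Sum>k\<in>?K. c (j, k) + sum c (down T k))"
    using reachable_if_mem_down not_reachable1_self
    by (intro sum.cong refl sum.insert finite_down) blast
  finally show ?thesis .
qed

text \<open>The recursion is solved from the leaves, where the sum over children is empty, up to the
  root; each level unfolds by \<open>sum_down\<close>.\<close>

lemma flow_eq_sum_down:
  fixes D :: "'a \<Rightarrow> 'a \<Rightarrow> 'b :: comm_monoid_add"
  assumes flow: "\<And>i j. (i, j) \<in> parcs T \<Longrightarrow> D i j = c i j + (\<Sum>k | (j, k) \<in> parcs T. D j k)"
    and "(i, j) \<in> parcs T"
  shows "D i j = c i j + (\<Sum>(\<alpha>, \<beta>) \<in> down T j. c \<alpha> \<beta>)"
proof -
  have "acyclic (parcs T)"
    using not_reachable1_self unfolding arcs_ends_eq by (simp add: acyclic_def)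
  \<comment> \<open>Under the converse relation the children of \<open>j\<close> are its
    predecessors, so the induction hypothesis applies to them.\<close>
  then have "wf ((parcs T)\<inverse>)"
    using finite_acyclic_wf_converse[OF pair_finite_arcs] by simp
  then show ?thesis
    using assms(2)
  proof (induction j arbitrary: i rule: wf_induct_rule)
    case (less j)
    then show ?case
      using flow[OF less.prems] by (simp add: sum_down[of _ j])
  qed
qed

text \<open>A path is a walk, so by uniqueness of walks \<open>w\<close> is the path chosen by
  \<open>THE\<close>.\<close>

lemma path_lines_eq_set:
  assumes "awalk root w h"
  shows "path_lines h = set w"
proof -
  have "h \<in> pverts T"
    using assms by (metis awalk_last_in_verts)
  then have "apath root (THE w. apath root w h) h"
    using theI'[OF unique_apath] by blast
  then show ?thesis
    unfolding path_lines_def using assms eq_awalk awalkI_apath by metis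
qed

text \<open>The increments telescope; the induction removes the last line of the walk, so that the
  start stays at the root.\<close>

lemma potential_eq_sum_list:
  fixes e :: "'a \<Rightarrow> 'b :: comm_monoid_add"
  assumes "e root = 0"
    and step: "\<And>i j. (i, j) \<in> parcs T \<Longrightarrow> e j = e i + f (i, j)"
    and "awalk root w h"
  shows "e h = sum_list (map f w)"
  using assms(3)
proof (induction w arbitrary: h rule: rev_induct)
  case Nil
  then show ?case
    using \<open>e root = 0\<close> by (simp add: awalk_Nil_iff)
next
  case (snoc a w)
  then obtain i where "awalk root w i" "a = (i, h)" "(i, h) \<in> parcs T"
    by (cases a) (auto simp: awalk_append_iff awalk_Cons_iff awalk_Nil_iff)
  with snoc.IH step show ?case
    by simp
qed

lemma potential_eq_sum_path_lines:
  fixes e :: "'a \<Rightarrow> 'b :: comm_monoid_add"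
  assumes "e root = 0"
    and "\<And>i j. (i, j) \<in> parcs T \<Longrightarrow> e j = e i + f (i, j)"
    and "h \<in> pverts T"
  shows "e h = sum f (path_lines h)"
proof -
  obtain w where "apath root w h"
    using unique_apath[OF assms(3)] by blast
  \<comment> \<open>A path repeats no line, so summing over its list agrees with summing over its
    set of lines.\<close>
  then have w: "awalk root w h" "distinct w"
    by (auto simp: apath_def distinct_verts_imp_distinct)
  have "e h = sum_list (map f w)"
    using assms(1,2) w(1) by (rule potential_eq_sum_list)
  also have "\<dots> = sum f (path_lines h)"
    using w by (simp add: path_lines_eq_set sum_list_distinct_conv_sum_set)
  finally show ?thesis .
qed

text \<open>Both models share the injections, which cancel in the difference and leave the line
  losses as the only sources.\<close>

lemma power_error_eq_loss:
  assumes nonlinear: "nonlinear_power_flow T r x p q P Q l v"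
    and linearized: "linearized_power_flow T r x p q P_hat Q_hat v_hat"
    and "(i, j) \<in> parcs T"
  shows "P i j - P_hat i j = r i j * l i j + (\<Sum>(\<alpha>, \<beta>) \<in> down T j. r \<alpha> \<beta> * l \<alpha> \<beta>)"
    and "Q i j - Q_hat i j = x i j * l i j + (\<Sum>(\<alpha>, \<beta>) \<in> down T j. x \<alpha> \<beta> * l \<alpha> \<beta>)"
proof -
  have "P i j - P_hat i j = r i j * l i j + (\<Sum>k | (j, k) \<in> parcs T. P j k - P_hat j k)"
    and "Q i j - Q_hat i j = x i j * l i j + (\<Sum>k | (j, k) \<in> parcs T. Q j k - Q_hat j k)"
    if "(i, j) \<in> parcs T" for i j
    using nonlinear linearized that
    unfolding nonlinear_power_flow_def linearized_power_flow_def
    by (fastforce simp: sum_subtractf)+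
  then show "P i j - P_hat i j = r i j * l i j + (\<Sum>(\<alpha>, \<beta>) \<in> down T j. r \<alpha> \<beta> * l \<alpha> \<beta>)"
    and "Q i j - Q_hat i j = x i j * l i j + (\<Sum>(\<alpha>, \<beta>) \<in> down T j. x \<alpha> \<beta> * l \<alpha> \<beta>)"
    using flow_eq_sum_down[of "\<lambda>i j. P i j - P_hat i j" "\<lambda>i j. r i j * l i j"]
      flow_eq_sum_down[of "\<lambda>i j. Q i j - Q_hat i j" "\<lambda>i j. x i j * l i j"] assms(3)
    by blast+
qed

end

theorem lemma1:
  fixes N :: nat and T :: "nat pair_pre_digraph"
    and r x P Q l P_hat Q_hat :: "nat \<Rightarrow> nat \<Rightarrow> real"
    and p q v v_hat g \<eta> :: "nat \<Rightarrow> real"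
  assumes nodes: "pverts T = {0..N}"
    and tree: "directed_tree T 0"
    and nonlinear: "nonlinear_power_flow T r x p q P Q l v"
    and linearized: "linearized_power_flow T r x p q P_hat Q_hat v_hat"
    and root_voltage: "v_hat 0 = v 0"
    and g: "\<And>\<xi>. \<xi> \<in> {1..N} \<Longrightarrow> g \<xi> = (\<Sum>(\<alpha>, \<beta>) \<in> down T \<xi>. r \<alpha> \<beta> * l \<alpha> \<beta>)"
    and \<eta>: "\<And>\<xi>. \<xi> \<in> {1..N} \<Longrightarrow> \<eta> \<xi> = (\<Sum>(\<alpha>, \<beta>) \<in> down T \<xi>. x \<alpha> \<beta> * l \<alpha> \<beta>)"
  shows "\<forall>h \<in> {1..N}. v_hat h - v h =
    (\<Sum>(\<zeta>, \<xi>) \<in> directed_tree.path_lines T 0 h.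
      2 * (r \<zeta> \<xi> * g \<xi> + x \<zeta> \<xi> * \<eta> \<xi>) + ((r \<zeta> \<xi>)\<^sup>2 + (x \<zeta> \<xi>)\<^sup>2) * l \<zeta> \<xi>)"
proof
  fix h assume h: "h \<in> {1..N}"
  interpret directed_tree T 0
    by (fact tree)
  show "v_hat h - v h = (\<Sum>(\<zeta>, \<xi>) \<in> path_lines h.
      2 * (r \<zeta> \<xi> * g \<xi> + x \<zeta> \<xi> * \<eta> \<xi>) + ((r \<zeta> \<xi>)\<^sup>2 + (x \<zeta> \<xi>)\<^sup>2) * l \<zeta> \<xi>)"
  proof (rule potential_eq_sum_path_lines)
    show "v_hat 0 - v 0 = 0"
      using root_voltage by simp
    show "h \<in> pverts T"
      using h nodes by simp
    fix i j assume line: "(i, j) \<in> parcs T"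
    \<comment> \<open>\<open>g\<close> and \<open>\<eta>\<close> are specified only away from the
      root, and no line enters the root.\<close>
    then have "j \<in> {1..N}"
      using nodes no_line_into_root in_arcsD2[OF line] by (cases j) auto
    then have P_error: "P i j = P_hat i j + r i j * l i j + g j"
      and Q_error: "Q i j = Q_hat i j + x i j * l i j + \<eta> j"
      using power_error_eq_loss[OF nonlinear linearized line] by (simp_all add: g \<eta>)
    have v: "v j = v i - 2 * (r i j * P i j + x i j * Q i j) + ((r i j)\<^sup>2 + (x i j)\<^sup>2) * l i j"
      using nonlinear line by (auto simp: nonlinear_power_flow_def cmod_power2)
    have v_hat: "v_hat j = v_hat i - 2 * (r i j * P_hat i j + x i j * Q_hat i j)"
      using linearized line by (auto simp: linearized_power_flow_def)
    show "v_hat j - v j = v_hat i - v i + (case (i, j) of (\<zeta>, \<xi>) \<Rightarrow>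
        2 * (r \<zeta> \<xi> * g \<xi> + x \<zeta> \<xi> * \<eta> \<xi>) + ((r \<zeta> \<xi>)\<^sup>2 + (x \<zeta> \<xi>)\<^sup>2) * l \<zeta> \<xi>)"
      unfolding v v_hat P_error Q_error by (simp add: algebra_simps power2_eq_square)
  qed
qed

end
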